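(* Let $m,c\ge 1$ be integers and let $F(m,c)$ be the hardware graph consisting of an $m\times m$ array of $K_{c,c}$ cells (as defined in the context). Write $\tau(G)$ for the treewidth of a graph $G$. Then: (1) the treewidth of a single cell (the case $m=1$) is $c$, i.e. $\tau(F(1,c))=c$; (2) for every $m\ge 2$, $$cm\le \tau(F(m,c))\le cm+c-1 .$$
   Context: All graphs are finite, simple and undirected. Hardware graph $F(m,c)$: its vertices are $v_{a,b}^{d}$ with $1\le a,b\le m$ and $1\le d\le 2c$ (so $2cm^2$ vertices), where $(a,b)$ is the (row, column) position of a cell in an $m\times m$ grid and $d$ is the position inside the cell. Positions $1,\dots,c$ form the left half of the cell and positions $c+1,\dots,2c$ the right half. The edges are exactly the following. - Inside each cell $(a,b)$: every left vertex is adjacent to every right vertex, i.e. $v_{a,b}^{d}v_{a,b}^{d'}$ for $1\le d\le c<d'\le 2c$, so the cell is a $K_{c,c}$. - Vertical couplings: $v_{a,b}^{d}v_{a+1,b}^{d}$ for $1\le a<m$, $1\le b\le m$, $1\le d\le c$ (each left vertex is joined to its image in the cells directly above and below). - Horizontal couplings: $v_{a,b}^{d}v_{a,b+1}^{d}$ for $1\le a\le m$, $1\le b<m$, $c+1\le d\le 2c$ (each right vertex is joined to its image in the cells directly to the left and right). Treewidth: a tree decomposition of $G=(V,E)$ is a tree $T$ with node set $I$ together with sets (bags) $V_i\subseteq V$, $i\in I$, such that $\bigcup_i V_i=V$, every edge of $G$ has both endpoints in some bag, and for every $v\in V$ the set $\{i: v\in V_i\}$ induces a connected subtree of $T$. Its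 width is $\max_{i}(|V_i|-1)$, and $\tau(G)$ is the minimum width over all tree decompositions of $G$. *)

theory Defs
  imports "Graph_Theory.Graph_Theory"
begin

text \<open>
  A finite simple undirected graph is a \<^locale>\<open>pair_graph\<close>: a finite, symmetric, loop-free digraph
  without parallel arcs, the edge \<open>uv\<close> being the two arcs \<open>(u, v)\<close> and \<open>(v, u)\<close>.
\<close>

section \<open>Trees\<close>

text \<open>
  The constant \<^const>\<open>tree\<close> forbids directed cycles. On a symmetric digraph \<open>u, v, u\<close> is such a
  cycle as soon as \<open>uv\<close> is an edge, so that constant does not describe undirected trees.
  In a \<^locale>\<open>pair_graph\<close> the cycles of the undirected graph are those of length at least 3.
\<close>

definition undirected_tree :: "'i pair_pre_digraph \<Rightarrow> bool" where
  "undirected_tree T \<longleftrightarrow>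
     pair_graph T \<and> connected (with_proj T) \<and>
     \<not> (\<exists>p. pre_digraph.cycle (with_proj T) p \<and> 3 \<le> length p)"


section \<open>Tree decompositions and treewidth\<close>

text \<open>
  In the last condition it suffices to ask for connectedness of the induced subgraph, which is
  then a subtree. \<^const>\<open>connected\<close> includes that the node set is nonempty.
\<close>

definition tree_decomposition ::
    "'a pair_pre_digraph \<Rightarrow> 'i pair_pre_digraph \<Rightarrow> ('i \<Rightarrow> 'a set) \<Rightarrow> bool" where
  "tree_decomposition G T bag \<longleftrightarrow>
     undirected_tree T \<and>
     (\<Union>i\<in>pverts T. bag i) = pverts G \<and>
     (\<forall>(u, v)\<in>parcs G. \<exists>i\<in>pverts T. u \<in> bag i \<and> v \<in> bag i) \<and>
     (\<forall>v\<in>pverts G. connected (with_proj T \<restriction> {i \<in> pverts T. v \<in> bag i}))"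

text \<open>Integer-valued, as the width is \<open>-1\<close> if all bags are empty.\<close>

definition decomposition_width :: "'i pair_pre_digraph \<Rightarrow> ('i \<Rightarrow> 'a set) \<Rightarrow> int" where
  "decomposition_width T bag = Max ((\<lambda>i. int (card (bag i)) - 1) ` pverts T)"

text \<open>
  Decomposition trees are finite, so taking their nodes to be natural numbers loses no generality.
\<close>

definition treewidth :: "'a pair_pre_digraph \<Rightarrow> int" where
  "treewidth G =
     (LEAST w. \<exists>(T :: nat pair_pre_digraph) bag.
        tree_decomposition G T bag \<and> w = decomposition_width T bag)"


section \<open>The hardware graph\<close>

text \<open>The triple \<open>(a, b, d)\<close> is the vertex in position \<open>d\<close> of the cell in row \<open>a\<close> and column \<open>b\<close>.\<close>

type_synonym hw_vertex = "nat \<times> nat \<times> nat"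

definition cell_edges :: "nat \<Rightarrow> nat \<Rightarrow> (hw_vertex \<times> hw_vertex) set" where
  "cell_edges m c = {((a, b, d), (a, b, d')) | a b d d'.
     a \<in> {1..m} \<and> b \<in> {1..m} \<and> 1 \<le> d \<and> d \<le> c \<and> c < d' \<and> d' \<le> 2 * c}"

definition vertical_edges :: "nat \<Rightarrow> nat \<Rightarrow> (hw_vertex \<times> hw_vertex) set" where
  "vertical_edges m c = {((a, b, d), (a + 1, b, d)) | a b d.
     1 \<le> a \<and> a < m \<and> b \<in> {1..m} \<and> d \<in> {1..c}}"

definition horizontal_edges :: "nat \<Rightarrow> nat \<Rightarrow> (hw_vertex \<times> hw_vertex) set" where
  "horizontal_edges m c = {((a, b, d), (a, b + 1, d)) | a b d.
     a \<in> {1..m} \<and> 1 \<le> b \<and> b < m \<and> d \<in> {c + 1..2 * c}}"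

definition hardware_edges :: "nat \<Rightarrow> nat \<Rightarrow> (hw_vertex \<times> hw_vertex) set" where
  "hardware_edges m c = cell_edges m c \<union> vertical_edges m c \<union> horizontal_edges m c"

text \<open>Each edge is listed above in one orientation; the converse supplies the opposite arcs.\<close>

definition hardware_graph :: "nat \<Rightarrow> nat \<Rightarrow> hw_vertex pair_pre_digraph" where
  "hardware_graph m c =
     \<lparr> pverts = {1..m} \<times> {1..m} \<times> {1..2 * c},
       parcs = hardware_edges m c \<union> (hardware_edges m c)\<inverse> \<rparr>"

lemma hardware_edges_subset:
  "hardware_edges m c \<subseteq> pverts (hardware_graph m c) \<times> pverts (hardware_graph m c)"
  by (auto simp: hardware_edges_def cell_edges_def vertical_edges_def horizontal_edges_def
      hardware_graph_def)

lemma hardware_edges_irrefl: "(u, u) \<notin> hardware_edges m c"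
  by (auto simp: hardware_edges_def cell_edges_def vertical_edges_def horizontal_edges_def)

lemma card_hardware_graph: "card (pverts (hardware_graph m c)) = 2 * c * m\<^sup>2"
  by (simp add: hardware_graph_def card_cartesian_product power2_eq_square)

lemma pair_graph_hardware_graph: "pair_graph (hardware_graph m c)"
proof -
  let ?V = "pverts (hardware_graph m c)" and ?E = "parcs (hardware_graph m c)"
  have fin: "finite ?V"
    by (simp add: hardware_graph_def)
  have sub: "?E \<subseteq> ?V \<times> ?V"
    using hardware_edges_subset[of m c] by (auto simp: hardware_graph_def)
  have finE: "finite ?E"
    using finite_subset[OF sub] fin by simp
  show ?thesis
  proof
    show "fst e \<in> ?V" "snd e \<in> ?V" if "e \<in> ?E" for e
      using that sub by auto
    show "fst e \<noteq> snd e" if "e \<in> ?E" for e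
      using that by (cases e) (auto simp: hardware_graph_def hardware_edges_irrefl)
    show "symmetric (with_proj (hardware_graph m c))"
      by (auto simp: symmetric_def hardware_graph_def intro: symI)
  qed (use fin finE in auto)
qed

end

theory Submission
  imports Defs
begin

text \<open>
  The treewidth is exactly \<open>c * m\<close>. For the lower bound, contract the \<open>c * m\<close> horizontal and the
  \<open>c * m\<close> vertical wires: every horizontal wire is joined to every vertical one in the cell where they
  cross, so this gives a complete bipartite minor. In a tree decomposition the nodes meeting a given
  wire form a subtree, and pruning leaves of the tree until a subtree has shrunk to a single node
  finds a bag that meets some wire of one kind and all wires of the other, hence has at least
  \<open>c * m + 1\<close> vertices.

  For the upper bound, sweep over the right vertices column by column, always keeping the last
  \<open>c * m + 1\<close> of them. Where a bag holds all right vertices of a column, attach for each vertical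
  wire of that column a path of bags running along the wire, which drops the right vertices of a
  cell once the wire has passed it.
\<close>

section \<open>Connected sets of nodes\<close>

text \<open>Stated for a bare relation, so that it serves both for wires in the graph and for node
  sets of a decomposition tree. The walks counted by \<open>rtrancl_on S E\<close> stay inside
  \<open>S\<close>.\<close>

definition connected_on :: "('a \<times> 'a) set \<Rightarrow> 'a set \<Rightarrow> bool" where
  "connected_on E S \<longleftrightarrow> S \<noteq> {} \<and> (\<forall>x\<in>S. \<forall>y\<in>S. (x, y) \<in> rtrancl_on S E)"

text \<open>On a symmetric relation the closure \<open>mk_symmetric\<close> adds no arcs, so what
  remains is that walks inside \<open>S\<close> use only arcs with both ends in
  \<open>S\<close>.\<close>

lemma connected_induce_subgraph_iff:
  assumes "sym (parcs T)"
  shows "connected (with_proj T \<restriction> S) \<longleftrightarrow> connected_on (parcs T) S"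
proof -
  have "mk_symmetric (with_proj T \<restriction> S) = \<lparr> pverts = S, parcs = {(u, v) \<in> parcs T. u \<in> S \<and> v \<in> S} \<rparr>"
    using assms by (auto simp: mk_symmetric_def induce_subgraph_def dest: symD)
  moreover have "(x, y) \<in> rtrancl_on S {(u, v) \<in> parcs T. u \<in> S \<and> v \<in> S}"
    if "(x, y) \<in> rtrancl_on S (parcs T)" for x y
    using that
    by (induct rule: rtrancl_on_induct) (auto intro: rtrancl_on_into_rtrancl_on)
  moreover have "(x, y) \<in> rtrancl_on S (parcs T)"
    if "(x, y) \<in> rtrancl_on S {(u, v) \<in> parcs T. u \<in> S \<and> v \<in> S}" for x y
    using that by (rule rtrancl_on_mono[rotated 2]) auto
  ultimately show ?thesis
    by (auto simp: connected_def strongly_connected_def reachable_def connected_on_def)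
qed

text \<open>Following the arcs along which \<open>f\<close> decreases must end at \<open>s\<close>;
  by symmetry the walk can be reversed. Wires, trees and the node sets of single vertices are all
  shown connected this way.\<close>

lemma connected_on_rooted:
  fixes f :: "'i \<Rightarrow> nat"
  assumes "sym E" "s \<in> S"
    and parent: "\<And>i. i \<in> S \<Longrightarrow> i \<noteq> s \<Longrightarrow> \<exists>j\<in>S. (i, j) \<in> E \<and> f j < f i"
  shows "connected_on E S"
proof -
  have root: "(i, s) \<in> rtrancl_on S E" if "i \<in> S" for i
    using that
  proof (induction "f i" arbitrary: i rule: less_induct)
    case less
    show ?case
    proof (cases "i = s")
      case False
      then obtain j where "j \<in> S" "(i, j) \<in> E" "f j < f i"
        using parent less.prems by blast
      then show ?thesis
        using less.hyps less.prems by (blast intro: converse_rtrancl_on_into_rtrancl_on)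
    qed (use less.prems in simp)
  qed
  moreover have "(s, i) \<in> rtrancl_on S E" if "i \<in> S" for i
    using root[OF that] rtrancl_on_sym[OF assms(1)] by (meson symD)
  ultimately show ?thesis
    unfolding connected_on_def using assms(2) by (blast intro: rtrancl_on_trans)
qed

section \<open>Leaf pruning and a Helly property of subtrees\<close>

text \<open>A walk that enters \<open>l\<close> has to leave it through the neighbour it came from,
  so the detour can be cut out.\<close>

lemma connected_on_remove_leaf:
  assumes "sym E" "connected_on E S"
    and leaf: "\<And>y z. y \<in> S \<Longrightarrow> z \<in> S \<Longrightarrow> (l, y) \<in> E \<Longrightarrow> (l, z) \<in> E \<Longrightarrow> y = z"
    and "S \<noteq> {l}"
  shows "connected_on E (S - {l})"
proof -
  have "(x, y) \<in> rtrancl_on (S - {l}) E" if xy: "x \<in> S - {l}" "y \<in> S - {l}" for x y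
  proof -
    have "(x, y) \<in> rtrancl_on S E"
      using assms(2) xy by (simp add: connected_on_def)
    \<comment> \<open>The induction needs an invariant for the moment when the walk sits on
      \<open>l\<close>: it records the neighbour \<open>q\<close> from which \<open>l\<close> was
      entered.\<close>
    then have "if y = l then \<exists>q\<in>S. (q, l) \<in> E \<and> (x, q) \<in> rtrancl_on (S - {l}) E
       else (x, y) \<in> rtrancl_on (S - {l}) E"
    proof (induct rule: rtrancl_on_induct)
      case base
      then show ?case using xy by auto
    next
      case (step y z)
      show ?case
      proof (cases "y = l")
        case True
        then obtain q where q: "q \<in> S" "(q, l) \<in> E" "(x, q) \<in> rtrancl_on (S - {l}) E"
          using step by auto
        have "z = q"
          using leaf[of z q] step q True assms(1) by (auto dest: symD)
        then show ?thesis
          using q in_rtrancl_on_in_F[OF q(3)] by auto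
      next
        case False
        then show ?thesis
          using step by (auto intro: rtrancl_on_into_rtrancl_on)
      qed
    qed
    then show ?thesis using xy by simp
  qed
  moreover have "S - {l} \<noteq> {}"
    using assms(2,4) by (auto simp: connected_on_def)
  ultimately show ?thesis
    by (auto simp: connected_on_def)
qed

lemma connected_on_neighbour:
  assumes "connected_on E S" "l \<in> S" "S \<noteq> {l}"
  obtains q where "q \<in> S" "q \<noteq> l" "(l, q) \<in> E"
proof -
  obtain y where y: "y \<in> S" "y \<noteq> l" using assms by blast
  then have "(l, y) \<in> rtrancl_on S E"
    using assms by (simp add: connected_on_def)
  then have "l \<noteq> y \<longrightarrow> (\<exists>q\<in>S. q \<noteq> l \<and> (l, q) \<in> E)"
  proof (induct rule: converse_rtrancl_on_induct)
    case (step x z)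
    then show ?case by (cases "z = x") blast+
  qed simp
  then show thesis using y that by blast
qed

text \<open>Prune a leaf \<open>l\<close> of \<open>I\<close>. If some set of one family is
  \<open>{l}\<close>, then \<open>l\<close> lies in every set of the other family. Otherwise delete
  \<open>l\<close> everywhere: the sets stay connected and crossing pairs still meet. Having a leaf
  is assumed for all nonempty subsets so that the assumption survives pruning.\<close>

lemma bipartite_Helly:
  fixes A B :: "'k \<Rightarrow> 'i set"
  assumes "finite I" "sym E"
    and leaf: "\<And>S. S \<subseteq> I \<Longrightarrow> S \<noteq> {} \<Longrightarrow>
      \<exists>l\<in>S. \<forall>y\<in>S. \<forall>z\<in>S. (l, y) \<in> E \<longrightarrow> (l, z) \<in> E \<longrightarrow> y = z"
    and "\<And>p. p \<in> P \<Longrightarrow> A p \<subseteq> I \<and> connected_on E (A p)"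
    and "\<And>q. q \<in> Q \<Longrightarrow> B q \<subseteq> I \<and> connected_on E (B q)"
    and "\<And>p q. p \<in> P \<Longrightarrow> q \<in> Q \<Longrightarrow> A p \<inter> B q \<noteq> {}"
    and "P \<noteq> {}" "Q \<noteq> {}"
  shows "\<exists>x\<in>I. (\<exists>p\<in>P. x \<in> A p) \<and> (\<forall>q\<in>Q. x \<in> B q) \<or> (\<exists>q\<in>Q. x \<in> B q) \<and> (\<forall>p\<in>P. x \<in> A p)"
  using assms(1,3-6)
proof (induction arbitrary: A B rule: finite_psubset_induct)
  case (psubset I)
  have "I \<noteq> {}"
    using psubset.prems(2,3,4) assms(7,8) by blast
  then obtain l where l: "l \<in> I"
    and uniq: "\<And>y z. y \<in> I \<Longrightarrow> z \<in> I \<Longrightarrow> (l, y) \<in> E \<Longrightarrow> (l, z) \<in> E \<Longrightarrow> y = z"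
    using psubset.prems(1)[of I] by blast
  show ?case
  proof (cases "(\<exists>p\<in>P. A p = {l}) \<or> (\<exists>q\<in>Q. B q = {l})")
    case True
    then show ?thesis
    proof
      assume "\<exists>p\<in>P. A p = {l}"
      then obtain p where "p \<in> P" "A p = {l}" by blast
      moreover from this have "l \<in> B q" if "q \<in> Q" for q
        using psubset.prems(4)[of p q] that by auto
      ultimately show ?thesis using l by auto
    next
      assume "\<exists>q\<in>Q. B q = {l}"
      then obtain q where "q \<in> Q" "B q = {l}" by blast
      moreover from this have "l \<in> A p" if "p \<in> P" for p
        using psubset.prems(4)[of p q] that by auto
      ultimately show ?thesis using l by auto
    qed
  next
    case False
    then have neA: "\<And>p. p \<in> P \<Longrightarrow> A p \<noteq> {l}" and neB: "\<And>q. q \<in> Q \<Longrightarrow> B q \<noteq> {l}"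
      by auto
    have "\<exists>x\<in>I - {l}. (\<exists>p\<in>P. x \<in> A p - {l}) \<and> (\<forall>q\<in>Q. x \<in> B q - {l}) \<or>
        (\<exists>q\<in>Q. x \<in> B q - {l}) \<and> (\<forall>p\<in>P. x \<in> A p - {l})"
    proof (rule psubset.IH)
      show "I - {l} \<subset> I" using l by auto
      show "\<exists>l\<in>S. \<forall>y\<in>S. \<forall>z\<in>S. (l, y) \<in> E \<longrightarrow> (l, z) \<in> E \<longrightarrow> y = z"
        if "S \<subseteq> I - {l}" "S \<noteq> {}" for S
        using psubset.prems(1)[of S] that by blast
      show "A p - {l} \<subseteq> I - {l} \<and> connected_on E (A p - {l})" if "p \<in> P" for p
      proof
        have "connected_on E (A p)" "A p \<subseteq> I"
          using psubset.prems(2) that by auto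
        then show "connected_on E (A p - {l})"
          using neA[OF that] uniq
          by (intro connected_on_remove_leaf[OF assms(2)]) (auto dest: subsetD)
      qed (use psubset.prems(2) that in auto)
      show "B q - {l} \<subseteq> I - {l} \<and> connected_on E (B q - {l})" if "q \<in> Q" for q
      proof
        have "connected_on E (B q)" "B q \<subseteq> I"
          using psubset.prems(3) that by auto
        then show "connected_on E (B q - {l})"
          using neB[OF that] uniq
          by (intro connected_on_remove_leaf[OF assms(2)]) (auto dest: subsetD)
      qed (use psubset.prems(3) that in auto)
      show "(A p - {l}) \<inter> (B q - {l}) \<noteq> {}" if pq: "p \<in> P" "q \<in> Q" for p q
      \<comment> \<open>If both sets contain \<open>l\<close>, each also contains a neighbour of
        \<open>l\<close>; a leaf has only one, so this neighbour is common to both.\<close>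
      proof (cases "l \<in> A p \<and> l \<in> B q")
        case True
        have "connected_on E (A p)" "A p \<subseteq> I" "connected_on E (B q)" "B q \<subseteq> I"
          using psubset.prems(2,3) pq by auto
        then obtain x y where "x \<in> A p" "x \<noteq> l" "(l, x) \<in> E" "y \<in> B q" "y \<noteq> l" "(l, y) \<in> E"
          using connected_on_neighbour[of E "A p" l] connected_on_neighbour[of E "B q" l]
            True neA[OF pq(1)] neB[OF pq(2)] by metis
        moreover from this have "x = y"
          using uniq psubset.prems(2,3) pq by blast
        ultimately show ?thesis by blast
      next
        case False
        then show ?thesis using psubset.prems(4)[OF pq] by blast
      qed
    qed
    then show ?thesis by blast
  qed
qed

text \<open>Take a longest path inside \<open>S\<close>. If its first vertex \<open>u\<close> had
  two neighbours in \<open>S\<close>, the one off the first arc would either prolong the path or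
  close a cycle of length at least 3.\<close>

lemma undirected_tree_leaf:
  assumes "undirected_tree T" "S \<subseteq> pverts T" "S \<noteq> {}"
  shows "\<exists>l\<in>S. \<forall>y\<in>S. \<forall>z\<in>S. (l, y) \<in> parcs T \<longrightarrow> (l, z) \<in> parcs T \<longrightarrow> y = z"
proof (rule ccontr)
  interpret T: pair_graph T
    using assms(1) by (simp add: undirected_tree_def)
  assume no_leaf: "\<not> ?thesis"
  define L where "L n \<longleftrightarrow> (\<exists>u p v. T.apath u p v \<and> set (pawalk_verts u p) \<subseteq> S \<and> length p = n)" for n
  obtain s where s: "s \<in> S" using assms(3) by blast
  have "L 0"
    unfolding L_def
    by (rule exI[of _ s], rule exI[of _ "[]"], rule exI[of _ s])
      (use s assms(2) in \<open>auto simp: T.apath_Nil_iff\<close>)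
  moreover have "n \<le> card (pverts T)" if "L n" for n
    using that T.length_apath_less unfolding L_def by fastforce
  ultimately obtain n where n: "L n" and max: "\<And>n'. L n' \<Longrightarrow> n' \<le> n"
    using Nat.ex_has_greatest_nat[of L 0 "card (pverts T)"] by blast
  obtain u p v where p: "T.apath u p v" "set (pawalk_verts u p) \<subseteq> S" "length p = n"
    using n unfolding L_def by blast
  have u: "u \<in> S" using p(1,2) T.hd_in_awalk_verts(2) by blast
  \<comment> \<open>Of two distinct neighbours of \<open>u\<close>, at least one differs from the
    second vertex \<open>snd (hd p)\<close> of the path.\<close>
  obtain y where y: "y \<in> S" "(u, y) \<in> parcs T" "p \<noteq> [] \<longrightarrow> y \<noteq> snd (hd p)"
    using no_leaf u by metis
  have yu: "(y, u) \<in> parcs T" "y \<noteq> u"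
    using y(2) T.graph_symmetric T.no_loops by fastforce+
  show False
  proof (cases "y \<in> set (pawalk_verts u p)")
    case False
    then have "T.apath y ((y, u) # p) v"
      using p yu by (auto simp: T.apath_Cons_iff)
    then have "L (Suc n)"
      unfolding L_def using p y(1)
      by (intro exI[of _ y] exI[of _ "(y, u) # p"] exI[of _ v]) auto
    then show False using max[of "Suc n"] by simp
  next
    case True
    have aw: "T.awalk u p v" using p(1) by (simp add: T.apath_def)
    obtain q r where qr: "p = q @ r" "T.awalk u q y" "T.awalk y r v"
      using T.awalk_decomp[OF aw True] by blast
    have "T.apath u q (last (pawalk_verts u q))"
      using p(1) qr(1) by (simp add: T.apath_append_iff)
    then have "distinct (pawalk_verts u q)"
      by (simp add: T.apath_def)
    then have "T.cycle ((y, u) # q)"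
      unfolding T.cycle_def using qr(2) yu(1)
      by (intro exI[of _ y]) (auto simp: T.awalk_Cons_iff)
    \<comment> \<open>The initial segment \<open>q\<close> of the path, from \<open>u\<close> to
      \<open>y\<close>, has at least two arcs: it is nonempty as \<open>y \<noteq> u\<close>, and
      not a single arc as \<open>y\<close> is not the second vertex of \<open>p\<close>.\<close>
    moreover have "3 \<le> length ((y, u) # q)"
    proof (cases q)
      case Nil
      then show ?thesis using qr(2) yu(2) by (auto simp: T.awalk_Nil_iff)
    next
      case (Cons e q')
      then show ?thesis
        using qr y(3) by (cases q') (auto simp: T.awalk_simps)
    qed
    ultimately show False
      using assms(1) unfolding undirected_tree_def by blast
  qed
qed

section \<open>Complete bipartite minors and treewidth\<close>

lemma tree_decomposition_sym: "tree_decomposition G T bag \<Longrightarrow> sym (parcs T)"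
proof -
  assume "tree_decomposition G T bag"
  then interpret pair_graph T
    by (simp add: tree_decomposition_def undirected_tree_def)
  show ?thesis
    using pair_sym_arcs by (simp add: symmetric_def)
qed

lemma tree_decomposition_bag_subset:
  "tree_decomposition G T bag \<Longrightarrow> i \<in> pverts T \<Longrightarrow> bag i \<subseteq> pverts G"
  unfolding tree_decomposition_def by auto

lemma tree_decomposition_arcE:
  assumes "tree_decomposition G T bag" "(u, v) \<in> parcs G"
  obtains i where "i \<in> pverts T" "u \<in> bag i" "v \<in> bag i"
  using assms unfolding tree_decomposition_def by (auto dest!: bspec)

lemma tree_decomposition_connected_on:
  assumes "tree_decomposition G T bag" "v \<in> pverts G"
  shows "connected_on (parcs T) {i \<in> pverts T. v \<in> bag i}"
  using assms connected_induce_subgraph_iff[OF tree_decomposition_sym[OF assms(1)]]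
  by (simp add: tree_decomposition_def)

lemma undirected_tree_finite:
  assumes "undirected_tree T"
  shows "finite (pverts T)"
proof -
  interpret pair_graph T
    using assms by (simp add: undirected_tree_def)
  show ?thesis by simp
qed

text \<open>The nodes whose bags contain a fixed vertex are connected, and for two adjacent vertices
  these node sets share a node. Walking through \<open>W\<close> links them all.\<close>

lemma connected_on_nodes_meeting:
  assumes dec: "tree_decomposition G T bag" and W: "W \<subseteq> pverts G" "connected_on (parcs G) W"
  shows "connected_on (parcs T) {i \<in> pverts T. bag i \<inter> W \<noteq> {}}" (is "connected_on _ ?N")
proof -
  let ?S = "\<lambda>v. {i \<in> pverts T. v \<in> bag i}"
  have S: "connected_on (parcs T) (?S v)" if "v \<in> W" for v
    using tree_decomposition_connected_on[OF dec] W(1) that by auto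
  have *: "\<forall>y\<in>?S v. (x, y) \<in> rtrancl_on ?N (parcs T)"
    if "(u, v) \<in> rtrancl_on W (parcs G)" and x: "x \<in> ?S u" for u v x
    using that(1)
  proof (induct rule: rtrancl_on_induct)
    case base
    show ?case
    proof
      fix y assume "y \<in> ?S u"
      then have "(x, y) \<in> rtrancl_on (?S u) (parcs T)"
        using S[OF base] x by (simp add: connected_on_def)
      then show "(x, y) \<in> rtrancl_on ?N (parcs T)"
        by (rule rtrancl_on_mono[OF subset_refl, rotated]) (use base in auto)
    qed
  next
    case (step v w)
    obtain i where i: "i \<in> ?S v" "i \<in> ?S w"
      using tree_decomposition_arcE[OF dec step(2)] by blast
    show ?case
    proof
      fix y assume "y \<in> ?S w"
      then have "(i, y) \<in> rtrancl_on (?S w) (parcs T)"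
        using S[OF step(4)] i by (simp add: connected_on_def)
      then have "(i, y) \<in> rtrancl_on ?N (parcs T)"
        by (rule rtrancl_on_mono[OF subset_refl, rotated]) (use step(4) in auto)
      then show "(x, y) \<in> rtrancl_on ?N (parcs T)"
        using step(5) i(1) by (blast intro: rtrancl_on_trans)
    qed
  qed
  obtain w where w: "w \<in> W"
    using W(2) by (auto simp: connected_on_def)
  then have "?S w \<noteq> {}"
    using S by (simp add: connected_on_def)
  then have "?N \<noteq> {}"
    using w by blast
  moreover have "(x, y) \<in> rtrancl_on ?N (parcs T)" if xy: "x \<in> ?N" "y \<in> ?N" for x y
  proof -
    obtain u v where uv: "u \<in> W" "x \<in> ?S u" "v \<in> W" "y \<in> ?S v"
      using xy by blast
    then have "(u, v) \<in> rtrancl_on W (parcs G)"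
      using W(2) by (simp add: connected_on_def)
    from *[OF this uv(2)] show ?thesis
      using uv(4) by (rule bspec)
  qed
  ultimately show ?thesis
    unfolding connected_on_def by (intro conjI ballI)
qed

text \<open>Choose one element of \<open>X\<close> in each \<open>B q\<close> and one in
  \<open>C\<close>. The element from \<open>C\<close> supplies the \<open>+ 1\<close> that offsets
  the \<open>- 1\<close> in the width.\<close>

lemma card_meeting_disjoint_family:
  assumes "finite X" "finite Q"
    and meet: "\<And>q. q \<in> Q \<Longrightarrow> X \<inter> B q \<noteq> {}"
    and disj: "\<And>q q'. q \<in> Q \<Longrightarrow> q' \<in> Q \<Longrightarrow> q \<noteq> q' \<Longrightarrow> B q \<inter> B q' = {}"
    and extra: "X \<inter> C \<noteq> {}" "\<And>q. q \<in> Q \<Longrightarrow> C \<inter> B q = {}"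
  shows "card Q + 1 \<le> card X"
proof -
  have "\<forall>q\<in>Q. \<exists>x. x \<in> X \<inter> B q"
    using meet by blast
  then obtain g where g: "\<And>q. q \<in> Q \<Longrightarrow> g q \<in> X \<inter> B q"
    by metis
  obtain x where x: "x \<in> X" "x \<in> C" using extra(1) by blast
  have "inj_on g Q"
    using g disj by (intro inj_onI) (metis IntE disjoint_iff)
  moreover have "x \<notin> g ` Q"
    using g extra(2) x by blast
  ultimately have "card (insert x (g ` Q)) = card Q + 1"
    using assms(2) by (simp add: card_image)
  moreover have "insert x (g ` Q) \<subseteq> X"
    using g x by auto
  ultimately show ?thesis
    using card_mono[OF assms(1)] by metis
qed

lemma decomposition_width_ge_card:
  assumes "tree_decomposition G T bag" "i \<in> pverts T"
  shows "int (card (bag i)) - 1 \<le> decomposition_width T bag"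
proof -
  have "finite (pverts T)"
    using assms(1) by (simp add: tree_decomposition_def undirected_tree_finite)
  then show ?thesis
    unfolding decomposition_width_def using assms(2) by (intro Max_ge) auto
qed

text \<open>The sets \<open>A p\<close> and \<open>B q\<close> are the branch sets of a complete bipartite minor.\<close>

lemma bipartite_minor_decomposition_width:
  fixes A B :: "'k \<Rightarrow> 'a set"
  assumes dec: "tree_decomposition G T bag" and "finite (pverts G)"
    and PQ: "card P = n" "card Q = n" "n \<ge> 1"
    and A: "\<And>p. p \<in> P \<Longrightarrow> A p \<subseteq> pverts G \<and> connected_on (parcs G) (A p)"
    and B: "\<And>q. q \<in> Q \<Longrightarrow> B q \<subseteq> pverts G \<and> connected_on (parcs G) (B q)"
    and arc: "\<And>p q. p \<in> P \<Longrightarrow> q \<in> Q \<Longrightarrow> \<exists>u\<in>A p. \<exists>v\<in>B q. (u, v) \<in> parcs G"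
    and disjA: "\<And>p p'. p \<in> P \<Longrightarrow> p' \<in> P \<Longrightarrow> p \<noteq> p' \<Longrightarrow> A p \<inter> A p' = {}"
    and disjB: "\<And>q q'. q \<in> Q \<Longrightarrow> q' \<in> Q \<Longrightarrow> q \<noteq> q' \<Longrightarrow> B q \<inter> B q' = {}"
    and disjAB: "\<And>p q. p \<in> P \<Longrightarrow> q \<in> Q \<Longrightarrow> A p \<inter> B q = {}"
  shows "int n \<le> decomposition_width T bag"
proof -
  let ?N = "\<lambda>W. {i \<in> pverts T. bag i \<inter> W \<noteq> {}}"
  have tree: "undirected_tree T"
    using dec by (simp add: tree_decomposition_def)
  have fin: "finite (pverts T)"
    using tree by (rule undirected_tree_finite)
  have finPQ: "finite P" "finite Q" "P \<noteq> {}" "Q \<noteq> {}"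
    using PQ by (auto intro: card_ge_0_finite)
  \<comment> \<open>The Helly property is applied to the node sets meeting each branch set; an arc
    between two branch sets lies in some bag, whose node is common to both node sets.\<close>
  have "\<exists>x\<in>pverts T. (\<exists>p\<in>P. x \<in> ?N (A p)) \<and> (\<forall>q\<in>Q. x \<in> ?N (B q)) \<or>
      (\<exists>q\<in>Q. x \<in> ?N (B q)) \<and> (\<forall>p\<in>P. x \<in> ?N (A p))"
  proof (rule bipartite_Helly[OF fin tree_decomposition_sym[OF dec]])
    show "\<exists>l\<in>S. \<forall>y\<in>S. \<forall>z\<in>S. (l, y) \<in> parcs T \<longrightarrow> (l, z) \<in> parcs T \<longrightarrow> y = z"
      if "S \<subseteq> pverts T" "S \<noteq> {}" for S
      using undirected_tree_leaf[OF tree that] .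
    show "?N (A p) \<subseteq> pverts T \<and> connected_on (parcs T) (?N (A p))" if "p \<in> P" for p
      using connected_on_nodes_meeting[OF dec] A[OF that] by auto
    show "?N (B q) \<subseteq> pverts T \<and> connected_on (parcs T) (?N (B q))" if "q \<in> Q" for q
      using connected_on_nodes_meeting[OF dec] B[OF that] by auto
    show "?N (A p) \<inter> ?N (B q) \<noteq> {}" if "p \<in> P" "q \<in> Q" for p q
    proof -
      obtain u v where uv: "u \<in> A p" "v \<in> B q" "(u, v) \<in> parcs G"
        using arc[OF \<open>p \<in> P\<close> \<open>q \<in> Q\<close>] by blast
      obtain i where "i \<in> pverts T" "u \<in> bag i" "v \<in> bag i"
        using tree_decomposition_arcE[OF dec uv(3)] .
      then show ?thesis using uv by blast
    qed
  qed (use finPQ in auto)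
  then obtain x where x: "x \<in> pverts T"
    and or: "(\<exists>p\<in>P. bag x \<inter> A p \<noteq> {}) \<and> (\<forall>q\<in>Q. bag x \<inter> B q \<noteq> {}) \<or>
      (\<exists>q\<in>Q. bag x \<inter> B q \<noteq> {}) \<and> (\<forall>p\<in>P. bag x \<inter> A p \<noteq> {})"
    by blast
  have fx: "finite (bag x)"
    using finite_subset[OF tree_decomposition_bag_subset[OF dec x] assms(2)] .
  from or have "n + 1 \<le> card (bag x)"
  proof
    assume H: "(\<exists>p\<in>P. bag x \<inter> A p \<noteq> {}) \<and> (\<forall>q\<in>Q. bag x \<inter> B q \<noteq> {})"
    then obtain p where "p \<in> P" "bag x \<inter> A p \<noteq> {}" by blast
    then have "card Q + 1 \<le> card (bag x)"
      using H disjAB by (intro card_meeting_disjoint_family[OF fx finPQ(2) _ disjB, where C = "A p"]) blast+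
    then show ?thesis using PQ(2) by simp
  next
    assume H: "(\<exists>q\<in>Q. bag x \<inter> B q \<noteq> {}) \<and> (\<forall>p\<in>P. bag x \<inter> A p \<noteq> {})"
    then obtain q where "q \<in> Q" "bag x \<inter> B q \<noteq> {}" by blast
    then have "card P + 1 \<le> card (bag x)"
      using H disjAB by (intro card_meeting_disjoint_family[OF fx finPQ(1) _ disjA, where C = "B q"]) blast+
    then show ?thesis using PQ(1) by simp
  qed
  then show ?thesis
    using decomposition_width_ge_card[OF dec x] by linarith
qed

section \<open>Tree decompositions from elimination orders\<close>

text \<open>On a cycle, consider a vertex where \<open>f\<close> is largest. Both its neighbours on
  the cycle have smaller \<open>f\<close>, so both are its parent, although on a cycle of length at
  least 3 they are distinct.\<close>

lemma rooted_tree_undirected_tree: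
  fixes f :: "'i \<Rightarrow> nat"
  assumes fin: "finite I" and r: "r \<in> I"
    and par: "\<And>i. i \<in> I - {r} \<Longrightarrow> par i \<in> I \<and> f (par i) < f i"
    and T: "T = \<lparr> pverts = I, parcs = (\<lambda>i. (i, par i)) ` (I - {r}) \<union> (\<lambda>i. (par i, i)) ` (I - {r}) \<rparr>"
  shows "undirected_tree T"
proof -
  have sym: "sym (parcs T)"
    by (auto simp: T intro: symI)
  interpret T: pair_graph T
  proof
    show "finite (pverts T)" "finite (parcs T)"
      using fin by (auto simp: T)
    show "fst e \<in> pverts T" "snd e \<in> pverts T" "fst e \<noteq> snd e" if "e \<in> parcs T" for e
      using that par by (fastforce simp: T)+
    show "symmetric (with_proj T)"
      using sym by (simp add: symmetric_def)
  qed
  have "connected_on (parcs T) I"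
    by (rule connected_on_rooted[OF sym r, of f]) (use par in \<open>auto simp: T\<close>)
  moreover have "with_proj T \<restriction> I = with_proj T"
    using par by (auto simp: induce_subgraph_def with_proj_def T)
  ultimately have "connected (with_proj T)"
    using connected_induce_subgraph_iff[OF sym, of I] by simp
  moreover have False if p: "T.cycle p" and len: "3 \<le> length p" for p
  proof -
    obtain u where u: "T.awalk u p u" "distinct (tl (pawalk_verts u p))" "p \<noteq> []"
      using p by (auto simp: T.cycle_def)
    then have "pcas u p u"
      by (simp add: T.awalk_def)
    then have "distinct (map snd p)"
      using u(2,3) T.awalk_verts_conv'[of u p u] by simp
    have "Max (f ` set (map snd p)) \<in> f ` set (map snd p)"
      using u(3) by (intro Max_in) auto
    then obtain w where w: "w \<in> set (map snd p)" "f w = Max (f ` set (map snd p))"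
      by (metis imageE)
    then have max: "f (snd e) \<le> f w" if "e \<in> set p" for e
      using that by auto
    have "w \<in> set (pawalk_verts u p)"
      using w(1) T.set_awalk_verts[OF u(1)] by auto
    then obtain q r' where qr: "p = q @ r'" "T.awalk w (r' @ q) w"
      using T.rotate_awalkE[OF u(1)] by metis
    \<comment> \<open>The cycle rotated so that it starts and ends at the maximal vertex
      \<open>w\<close>.\<close>
    define c where "c = r' @ q"
    have c: "length c = length p" "set c = set p" "distinct (map snd c)" "set c \<subseteq> parcs T" "pcas w c w"
      using qr \<open>distinct (map snd p)\<close> u(1) by (auto simp: c_def T.awalk_def)
    have f: "f x < f y \<longrightarrow> x = par y" if "(x, y) \<in> parcs T" for x y
      using that par by (fastforce simp: T)
    have f': "f x \<noteq> f y" if "(x, y) \<in> parcs T" for x y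
      using that par by (fastforce simp: T)
    obtain x c' where c1: "c = (w, x) # c'"
      using c(1,5) len by (cases c) auto
    obtain y c'' where c2: "c' = c'' @ [(y, w)]"
      using c(1,5) len c1 by (cases c' rule: rev_cases) auto
    \<comment> \<open>Length at least 3 enters here: some arc of \<open>c''\<close> ends in
      \<open>y\<close>, and since no two arcs of \<open>c\<close> have the same head,
      \<open>y\<close> differs from the head \<open>x\<close> of the first arc.\<close>
    have "c'' \<noteq> []"
      using c(1) len c1 c2 by auto
    have sub: "(w, x) \<in> parcs T" "(y, w) \<in> parcs T"
      using c(4) c1 c2 by auto
    have "snd (last c'') = y"
      using c(5) c1 c2 \<open>c'' \<noteq> []\<close> by (simp add: T.cas_append_iff T.awalk_verts_conv)
    then have "y \<in> snd ` set c''"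
      using \<open>c'' \<noteq> []\<close> by (metis imageI last_in_set)
    then have "x \<noteq> y"
      using c(3) c1 c2 by auto
    have "y \<in> snd ` set p" "x \<in> snd ` set p"
      using \<open>y \<in> snd ` set c''\<close> c(2) c1 c2 by force+
    then have "f y \<le> f w" "f x \<le> f w"
      using max by auto
    then have "f x < f w" "f y < f w"
      using f'[OF sub(1)] f'[OF sub(2)] by simp_all
    then have "x = par w" "y = par w"
      using f[of x w] f[of y w] sub symD[OF sym sub(1)] by simp_all
    then show False using \<open>x \<noteq> y\<close> by simp
  qed
  ultimately show ?thesis
    unfolding undirected_tree_def using T.pair_graph_axioms by blast
qed

text \<open>Listed by \<open>f\<close>, the vertices form a reversed elimination order.\<close>

lemma elimination_tree_decomposition:
  fixes f :: "'a \<Rightarrow> nat" and G :: "'a pair_pre_digraph"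
  assumes fin: "finite (pverts G)" and r: "r \<in> pverts G" "N r = {}"
    and par: "\<And>v. v \<in> pverts G - {r} \<Longrightarrow>
      par v \<in> pverts G \<and> f (par v) < f v \<and> N v \<subseteq> insert (par v) (N (par v))"
    and N: "\<And>v. v \<in> pverts G \<Longrightarrow> N v \<subseteq> pverts G \<and> card (N v) \<le> k"
    and arcs: "\<And>u v. (u, v) \<in> parcs G \<Longrightarrow> u \<in> pverts G \<and> v \<in> pverts G \<and> (u \<in> N v \<or> v \<in> N u)"
  obtains T :: "nat pair_pre_digraph" and bag
  where "tree_decomposition G T bag" "decomposition_width T bag \<le> int k"
proof -
  let ?V = "pverts G"
  \<comment> \<open>The tree has one node \<open>h v\<close> for each vertex \<open>v\<close>, with
    bag \<open>insert v (N v)\<close>; the injection \<open>h\<close> is there because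
    \<open>treewidth\<close> takes nodes in \<open>nat\<close>.\<close>
  obtain h :: "'a \<Rightarrow> nat" where h: "inj_on h ?V"
    using finite_imp_inj_to_nat_seg[OF fin] by blast
  define g where "g = inv_into ?V h"
  have gh: "g (h v) = v" if "v \<in> ?V" for v
    using h that by (simp add: g_def)
  define T where "T = \<lparr> pverts = h ` ?V,
    parcs = (\<lambda>i. (i, h (par (g i)))) ` (h ` ?V - {h r}) \<union> (\<lambda>i. (h (par (g i)), i)) ` (h ` ?V - {h r}) \<rparr>"
  define bag where "bag i = insert (g i) (N (g i))" for i
  have bag: "bag (h v) = insert v (N v)" if "v \<in> ?V" for v
    using gh[OF that] by (simp add: bag_def)
  have tree: "undirected_tree T"
  proof (rule rooted_tree_undirected_tree[OF _ _ _ T_def])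
    show "h (par (g i)) \<in> h ` ?V \<and> f (g (h (par (g i)))) < f (g i)" if i: "i \<in> h ` ?V - {h r}" for i
    proof -
      obtain v where "v \<in> ?V - {r}" "i = h v" using i by blast
      then show ?thesis using par[of v] gh by simp
    qed
  qed (use fin r in auto)
  have sym: "sym (parcs T)"
    by (auto simp: T_def intro: symI)
  have parT: "(h v, h (par v)) \<in> parcs T" if "v \<in> ?V - {r}" for v
    using that r(1) gh[of v] inj_onD[OF h, of v r] by (fastforce simp: T_def)
  \<comment> \<open>The subtree of \<open>x\<close> is rooted at \<open>h x\<close>. At any other
    node \<open>h v\<close> of it, \<open>x\<close> is in \<open>N v\<close>; the inclusion in
    \<open>par\<close> puts \<open>x\<close> into the bag of the parent.\<close>
  have conn: "connected_on (parcs T) {i \<in> pverts T. x \<in> bag i}" (is "connected_on _ ?S") if x: "x \<in> ?V" for x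
  proof (rule connected_on_rooted[OF sym, of "h x" _ "f \<circ> g"])
    show "h x \<in> ?S"
      using x bag by (simp add: T_def)
    show "\<exists>j\<in>?S. (i, j) \<in> parcs T \<and> (f \<circ> g) j < (f \<circ> g) i" if i: "i \<in> ?S" "i \<noteq> h x" for i
    proof -
      obtain v where v: "v \<in> ?V" "i = h v" using i by (auto simp: T_def)
      then have "x \<in> N v"
        using i bag[of v] by auto
      then have "v \<in> ?V - {r}"
        using v r by auto
      moreover from this have "x \<in> bag (h (par v))"
        using par[of v] bag[of "par v"] \<open>x \<in> N v\<close> by auto
      ultimately show ?thesis
        using par[of v] parT[of v] v gh by (intro bexI[of _ "h (par v)"]) (auto simp: T_def)
    qed
  qed
  have "(\<Union>i\<in>pverts T. bag i) = ?V"
    using bag N by (fastforce simp: T_def)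
  moreover have "\<exists>i\<in>pverts T. u \<in> bag i \<and> v \<in> bag i" if "(u, v) \<in> parcs G" for u v
    using arcs[OF that] bag by (auto simp: T_def)
  ultimately have "tree_decomposition G T bag"
    unfolding tree_decomposition_def
    using tree conn connected_induce_subgraph_iff[OF sym] by auto
  moreover have "decomposition_width T bag \<le> int k"
    unfolding decomposition_width_def
  proof (rule Max.boundedI)
    show "w \<le> int k" if w: "w \<in> (\<lambda>i. int (card (bag i)) - 1) ` pverts T" for w
    proof -
      obtain v where v: "v \<in> ?V" "w = int (card (bag (h v))) - 1"
        using w by (auto simp: T_def)
      have "card (insert v (N v)) \<le> k + 1"
        using N[OF v(1)] card_insert_le_m1 [of "k + 1" "N v" v] by simp
      then show ?thesis
        using v bag by simp
    qed
  qed (use fin r in \<open>auto simp: T_def\<close>)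
  ultimately show thesis by (rule that)
qed

section \<open>The hardware graph\<close>

lemma horizontal_wire_connected:
  assumes "m \<ge> 1" "a \<in> {1..m}" "d \<in> {c + 1..2 * c}"
  shows "connected_on (parcs (hardware_graph m c)) ((\<lambda>b. (a, b, d)) ` {1..m})"
proof (rule connected_on_rooted[where f = "\<lambda>(a, b, d). b" and s = "(a, 1, d)"])
  show "sym (parcs (hardware_graph m c))"
    by (auto simp: hardware_graph_def intro: symI)
  show "\<exists>j\<in>(\<lambda>b. (a, b, d)) ` {1..m}. (i, j) \<in> parcs (hardware_graph m c) \<and>
      (case j of (a, b, d) \<Rightarrow> b) < (case i of (a, b, d) \<Rightarrow> b)"
    if "i \<in> (\<lambda>b. (a, b, d)) ` {1..m}" "i \<noteq> (a, 1, d)" for i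
  proof -
    obtain b where b: "i = (a, b, d)" "1 < b" "b \<le> m"
      using \<open>i \<in> _\<close> \<open>i \<noteq> _\<close> by (auto simp: le_less)
    then have "((a, b - 1, d), i) \<in> horizontal_edges m c"
      using assms unfolding horizontal_edges_def by fastforce
    then show ?thesis
      using b by (intro bexI[of _ "(a, b - 1, d)"])
        (auto simp: hardware_graph_def hardware_edges_def intro!: image_eqI[of _ _ "b - 1"])
  qed
qed (use assms in auto)

lemma vertical_wire_connected:
  assumes "m \<ge> 1" "b \<in> {1..m}" "d \<in> {1..c}"
  shows "connected_on (parcs (hardware_graph m c)) ((\<lambda>a. (a, b, d)) ` {1..m})"
proof (rule connected_on_rooted[where f = fst and s = "(1, b, d)"])
  show "sym (parcs (hardware_graph m c))"
    by (auto simp: hardware_graph_def intro: symI)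
  show "\<exists>j\<in>(\<lambda>a. (a, b, d)) ` {1..m}. (i, j) \<in> parcs (hardware_graph m c) \<and> fst j < fst i"
    if "i \<in> (\<lambda>a. (a, b, d)) ` {1..m}" "i \<noteq> (1, b, d)" for i
  proof -
    obtain a where a: "i = (a, b, d)" "1 < a" "a \<le> m"
      using \<open>i \<in> _\<close> \<open>i \<noteq> _\<close> by (auto simp: le_less)
    then have "((a - 1, b, d), i) \<in> vertical_edges m c"
      using assms unfolding vertical_edges_def by fastforce
    then show ?thesis
      using a by (intro bexI[of _ "(a - 1, b, d)"])
        (auto simp: hardware_graph_def hardware_edges_def intro!: image_eqI[of _ _ "a - 1"])
  qed
qed (use assms in auto)

lemma hardware_graph_decomposition_width:
  assumes "m \<ge> 1" "c \<ge> 1" and dec: "tree_decomposition (hardware_graph m c) T bag"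
  shows "int (c * m) \<le> decomposition_width T bag"
proof -
  let ?G = "hardware_graph m c"
  \<comment> \<open>A horizontal wire is named by its row and position, a vertical one by its column
    and position. They cross in the cell with that row and column.\<close>
  let ?P = "{1..m} \<times> {c + 1..2 * c}" and ?Q = "{1..m} \<times> {1..c}"
  let ?A = "\<lambda>p. (\<lambda>b. (fst p, b, snd p)) ` {1..m}" and ?B = "\<lambda>q. (\<lambda>a. (a, q)) ` {1..m}"
  show ?thesis
  proof (rule bipartite_minor_decomposition_width[OF dec, where P = ?P and Q = ?Q and A = ?A and B = ?B])
    show "finite (pverts ?G)" by (simp add: hardware_graph_def)
    show "card ?P = c * m" "card ?Q = c * m" "c * m \<ge> 1"
      using assms by (simp_all add: card_cartesian_product)
    show "?A p \<subseteq> pverts ?G \<and> connected_on (parcs ?G) (?A p)" if "p \<in> ?P" for p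
      using that horizontal_wire_connected[OF assms(1), of "fst p" "snd p" c]
      by (auto simp: hardware_graph_def)
    show "?B q \<subseteq> pverts ?G \<and> connected_on (parcs ?G) (?B q)" if "q \<in> ?Q" for q
      using that vertical_wire_connected[OF assms(1), of "fst q" "snd q" c]
      by (auto simp: hardware_graph_def)
    show "\<exists>u\<in>?A p. \<exists>v\<in>?B q. (u, v) \<in> parcs ?G" if pq: "p \<in> ?P" "q \<in> ?Q" for p q
    proof (intro bexI)
      show "((fst p, fst q, snd p), (fst p, q)) \<in> parcs ?G"
        using pq by (auto simp: hardware_graph_def hardware_edges_def cell_edges_def)
    qed (use pq in auto)
    show "?A p \<inter> ?B q = {}" if "p \<in> ?P" "q \<in> ?Q" for p q
      using that by auto
  qed (auto simp: prod_eq_iff)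
qed

section \<open>Upper bound: an elimination order of the hardware graph\<close>

text \<open>
  Right vertices are numbered consecutively, column by column, so that a horizontal coupling joins
  two vertices whose numbers differ by \<open>m * c\<close>.
\<close>

definition right_index :: "nat \<Rightarrow> nat \<Rightarrow> hw_vertex \<Rightarrow> nat" where
  "right_index m c = (\<lambda>(a, b, d). (b * m + a) * c + d)"

definition right_vertices :: "nat \<Rightarrow> nat \<Rightarrow> hw_vertex set" where
  "right_vertices m c = {1..m} \<times> {1..m} \<times> {c + 1..2 * c}"

text \<open>The largest right index is \<open>(m * m + m) * c + 2 * c\<close>, so all left vertices
  come after all right ones. Among them the bottom row \<open>m\<close> comes first, because the
  branch of a wire is attached at its bottom end.\<close>

definition hw_rank :: "nat \<Rightarrow> nat \<Rightarrow> hw_vertex \<Rightarrow> nat" where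
  "hw_rank m c = (\<lambda>(a, b, d).
     if d \<le> c then (m * m + m) * c + 2 * c + 1 + (m - a) else right_index m c (a, b, d))"

text \<open>The right vertices form a path in the order of \<open>right_index\<close>, with root
  \<open>(1, 1, c + 1)\<close>. Each vertical wire of column \<open>b\<close> is a branch hung on
  \<open>(m, b, 2 * c)\<close>, the last right vertex of that column.\<close>

definition hw_parent :: "nat \<Rightarrow> nat \<Rightarrow> hw_vertex \<Rightarrow> hw_vertex" where
  "hw_parent m c = (\<lambda>(a, b, d).
     if d \<le> c then (if a < m then (a + 1, b, d) else (m, b, 2 * c))
     else if c + 1 < d then (a, b, d - 1)
     else if 1 < a then (a - 1, b, 2 * c)
     else (m, b - 1, 2 * c))"

text \<open>The bag of a vertex without the vertex itself. It may contain more than the earlier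
  neighbours: a right vertex keeps the window of the preceding \<open>m * c\<close> right vertices,
  and a left vertex keeps the right vertices of its column in the rows not yet passed.\<close>

definition hw_earlier :: "nat \<Rightarrow> nat \<Rightarrow> hw_vertex \<Rightarrow> hw_vertex set" where
  "hw_earlier m c = (\<lambda>(a, b, d).
     if d \<le> c then {1..a} \<times> {b} \<times> {c + 1..2 * c} \<union> (if a < m then {(a + 1, b, d)} else {})
     else {w \<in> right_vertices m c. right_index m c w < right_index m c (a, b, d) \<and>
       right_index m c (a, b, d) \<le> right_index m c w + m * c})"

text \<open>Division with remainder, with remainders taken from a window starting at
  \<open>s\<close>: positions of right vertices start at \<open>c + 1\<close> and rows at 1.\<close>

lemma div_mod_unique_shift:
  fixes c :: nat
  assumes "q * c + r = q' * c + r'" "s \<le> r" "r < s + c" "s \<le> r'" "r' < s + c"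
  shows "q = q' \<and> r = r'"
proof -
  obtain x x' where x: "r = s + x" "x < c" "r' = s + x'" "x' < c"
    using assms(2-5) by (metis le_iff_add nat_add_left_cancel_less)
  then have eq: "x + q * c = x' + q' * c"
    using assms(1) by simp
  have "q = (x + q * c) div c" "q' = (x' + q' * c) div c"
    using x by simp_all
  then have "q = q'"
    using eq by simp
  then show ?thesis using assms(1) by simp
qed

lemma right_index_inj: "inj_on (right_index m c) (right_vertices m c)"
proof (rule inj_onI)
  fix v w assume vw: "v \<in> right_vertices m c" "w \<in> right_vertices m c"
    "right_index m c v = right_index m c w"
  obtain a b d a' b' d' where v: "v = (a, b, d)" and w: "w = (a', b', d')"
    by (cases v, cases w) auto
  have "b * m + a = b' * m + a' \<and> d = d'"
    using vw unfolding v w by (intro div_mod_unique_shift[of _ c _ _ _ "c + 1"])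
      (auto simp: right_index_def right_vertices_def)
  moreover from this have "b = b' \<and> a = a'"
    using vw unfolding v w by (intro div_mod_unique_shift[of _ m _ _ _ 1])
      (auto simp: right_vertices_def)
  ultimately show "v = w" by (simp add: v w)
qed

lemma right_index_le:
  assumes "(a, b, d) \<in> right_vertices m c" "a \<le> a'" "b \<le> b'"
  shows "right_index m c (a, b, d) \<le> right_index m c (a', b', 2 * c)"
proof -
  have "(b * m + a) * c \<le> (b' * m + a') * c"
    using assms(2,3) by (intro mult_le_mono1 add_mono) auto
  moreover have "d \<le> 2 * c"
    using assms(1) by (simp add: right_vertices_def)
  ultimately show ?thesis
    unfolding right_index_def prod.case by (rule add_mono)
qed

lemma right_index_ge:
  assumes "(a, b, d) \<in> right_vertices m c"
  shows "right_index m c (1, 1, c + 1) \<le> right_index m c (a, b, d)"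
proof -
  have "(1 * m + 1) * c \<le> (b * m + a) * c"
    using assms by (intro mult_le_mono1 add_mono) (auto simp: right_vertices_def)
  then show ?thesis using assms by (simp add: right_index_def right_vertices_def)
qed

text \<open>The numbering has no gaps at the end of a cell or column: from position
  \<open>2 * c\<close> to position \<open>c + 1\<close> of the next cell, the cell term grows by
  \<open>c\<close> while the position drops by \<open>c - 1\<close>.\<close>

lemma right_index_parent:
  assumes "(a, b, d) \<in> right_vertices m c" "(a, b, d) \<noteq> (1, 1, c + 1)"
  shows "hw_parent m c (a, b, d) \<in> right_vertices m c \<and>
    Suc (right_index m c (hw_parent m c (a, b, d))) = right_index m c (a, b, d)"
proof -
  consider "c + 1 < d" | "d = c + 1" "1 < a" | "d = c + 1" "a = 1" "1 < b"
    using assms by (fastforce simp: right_vertices_def)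
  then show ?thesis
  proof cases
    case 1
    then show ?thesis
      using assms by (auto simp: right_vertices_def hw_parent_def right_index_def)
  next
    case 2
    then obtain a' where "a = Suc a'" by (cases a) auto
    then show ?thesis
      using assms 2 by (auto simp: right_vertices_def hw_parent_def right_index_def algebra_simps)
  next
    case 3
    then obtain b' where "b = Suc b'" by (cases b) auto
    then show ?thesis
      using assms 3 by (auto simp: right_vertices_def hw_parent_def right_index_def algebra_simps)
  qed
qed

lemma hw_earlier_right:
  assumes "v \<in> right_vertices m c"
  shows "hw_earlier m c v = {w \<in> right_vertices m c. right_index m c w < right_index m c v \<and>
       right_index m c v \<le> right_index m c w + m * c}"
  using assms by (auto simp: hw_earlier_def right_vertices_def split: prod.splits)

lemma hw_parent_earlier:
  assumes "m \<ge> 1" "c \<ge> 1" "v \<in> pverts (hardware_graph m c) - {(1, 1, c + 1)}"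
  shows "hw_parent m c v \<in> pverts (hardware_graph m c) \<and> hw_rank m c (hw_parent m c v) < hw_rank m c v \<and>
    hw_earlier m c v \<subseteq> insert (hw_parent m c v) (hw_earlier m c (hw_parent m c v))"
proof -
  obtain a b d where v: "v = (a, b, d)" by (cases v) auto
  have V: "a \<in> {1..m}" "b \<in> {1..m}" "d \<in> {1..2 * c}" "(a, b, d) \<noteq> (1, 1, c + 1)"
    using assms(3) by (auto simp: v hardware_graph_def)
  consider "d \<le> c" "a < m" | "d \<le> c" "a = m" | "c < d"
    using V by fastforce
  then show ?thesis
  proof cases
    case 1
    then show ?thesis
      using V by (auto simp: v hw_parent_def hw_rank_def hw_earlier_def hardware_graph_def)
  next
    case 2
    let ?p = "(m, b, 2 * c)"
    have p: "hw_parent m c v = ?p"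
      using 2 by (simp add: v hw_parent_def)
    have pR: "?p \<in> right_vertices m c"
      using V assms(1,2) by (auto simp: right_vertices_def)
    have "right_index m c ?p \<le> right_index m c (m, m, 2 * c)"
      using right_index_le[OF pR] V by simp
    moreover have "hw_rank m c ?p = right_index m c ?p"
      using assms(2) by (simp add: hw_rank_def)
    moreover have "hw_rank m c v = Suc (right_index m c (m, m, 2 * c))"
      using 2 by (simp add: v hw_rank_def right_index_def)
    ultimately have "hw_rank m c ?p < hw_rank m c v"
      by linarith
    \<comment> \<open>At the foot of a wire all \<open>m * c\<close> right vertices of the column
      are needed. They are consecutive and end in \<open>?p\<close>, so \<open>?p\<close> and its
      window cover them.\<close>
    moreover have "hw_earlier m c v \<subseteq> insert ?p (hw_earlier m c ?p)"
    proof
      fix w assume "w \<in> hw_earlier m c v"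
      then obtain a' d' where w: "w = (a', b, d')" "a' \<in> {1..m}" "d' \<in> {c + 1..2 * c}"
        using 2 by (auto simp: v hw_earlier_def)
      then have wR: "w \<in> right_vertices m c"
        using V by (simp add: right_vertices_def)
      have "right_index m c w \<le> right_index m c ?p"
        using right_index_le wR w by simp
      then have "w = ?p \<or> right_index m c w < right_index m c ?p"
        using inj_onD[OF right_index_inj _ wR pR] by linarith
      moreover have "right_index m c w + m * c = (b * m + m) * c + a' * c + d'"
        using w by (simp add: right_index_def algebra_simps)
      moreover have "right_index m c ?p = (b * m + m) * c + 2 * c"
        by (simp add: right_index_def)
      moreover have "1 * c \<le> a' * c"
        using w(2) by (intro mult_le_mono1) simp
      moreover have "c + 1 \<le> d'"
        using w(3) by simp
      ultimately have "w = ?p \<or> right_index m c w < right_index m c ?p"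
        "right_index m c ?p \<le> right_index m c w + m * c"
        by linarith+
      then show "w \<in> insert ?p (hw_earlier m c ?p)"
        using wR hw_earlier_right[OF pR] by auto
    qed
    ultimately show ?thesis
      using V assms(1,2) by (simp add: p hardware_graph_def)
  next
    case 3
    let ?p = "hw_parent m c v"
    have vR: "v \<in> right_vertices m c"
      using V 3 by (simp add: v right_vertices_def)
    then have p: "?p \<in> right_vertices m c" "Suc (right_index m c ?p) = right_index m c v"
      using right_index_parent V by (simp_all add: v)
    have rank: "hw_rank m c w = right_index m c w" if "w \<in> right_vertices m c" for w
      using that by (auto simp: hw_rank_def right_vertices_def)
    \<comment> \<open>The parent has the preceding number, so its window starts one earlier and
      misses at most the parent itself.\<close>
    have "hw_earlier m c v \<subseteq> insert ?p (hw_earlier m c ?p)"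
    proof
      fix w assume "w \<in> hw_earlier m c v"
      then have w: "w \<in> right_vertices m c" "right_index m c w < right_index m c v"
        "right_index m c v \<le> right_index m c w + m * c"
        using hw_earlier_right[OF vR] by auto
      then have "w = ?p \<or> right_index m c w < right_index m c ?p"
        using inj_onD[OF right_index_inj _ w(1) p(1)] p(2) by linarith
      then show "w \<in> insert ?p (hw_earlier m c ?p)"
        using w p(2) hw_earlier_right[OF p(1)] by auto
    qed
    moreover have "?p \<in> pverts (hardware_graph m c)"
      using p(1) by (auto simp: right_vertices_def hardware_graph_def)
    ultimately show ?thesis
      using rank[OF p(1)] rank[OF vR] p(2) by simp
  qed
qed

lemma hw_earlier_bounds:
  assumes "c \<ge> 1" "v \<in> pverts (hardware_graph m c)"
  shows "hw_earlier m c v \<subseteq> pverts (hardware_graph m c) \<and> card (hw_earlier m c v) \<le> c * m"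
proof -
  obtain a b d where v: "v = (a, b, d)" by (cases v) auto
  have V: "a \<in> {1..m}" "b \<in> {1..m}" "d \<in> {1..2 * c}"
    using assms(2) by (auto simp: v hardware_graph_def)
  have sub: "hw_earlier m c v \<subseteq> pverts (hardware_graph m c)"
    using V by (auto simp: v hw_earlier_def right_vertices_def hardware_graph_def split: if_splits)
  let ?L = "{1..a} \<times> {b} \<times> {c + 1..2 * c}"
  have cardL: "card ?L = a * c"
    by (simp add: card_cartesian_product)
  consider "d \<le> c" "a < m" | "d \<le> c" "a = m" | "c < d"
    using V by fastforce
  then have "card (hw_earlier m c v) \<le> c * m"
  proof cases
    case 1
    then have "hw_earlier m c v = insert (a + 1, b, d) ?L"
      by (simp add: v hw_earlier_def)
    \<comment> \<open>The one extra wire vertex is paid for by the \<open>c\<close> right vertices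
      of row \<open>a + 1\<close>, which are absent.\<close>
    then have "card (hw_earlier m c v) \<le> a * c + c"
      using cardL assms(1) by (simp add: card_insert_if)
    also have "\<dots> = Suc a * c" by simp
    also have "\<dots> \<le> m * c"
      using 1 by (intro mult_le_mono1) simp
    finally show ?thesis by (simp add: mult.commute)
  next
    case 2
    then show ?thesis
      using cardL by (simp add: v hw_earlier_def mult.commute)
  next
    case 3
    then have vR: "v \<in> right_vertices m c"
      using V by (simp add: v right_vertices_def)
    let ?t = "right_index m c"
    have "card (hw_earlier m c v) = card (?t ` hw_earlier m c v)"
      unfolding hw_earlier_right[OF vR]
      by (intro card_image[symmetric] inj_on_subset[OF right_index_inj]) auto
    also have "\<dots> \<le> card {?t v - m * c..<?t v}"
      unfolding hw_earlier_right[OF vR] by (intro card_mono) auto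
    also have "\<dots> \<le> c * m" by (simp add: mult.commute)
    finally show ?thesis .
  qed
  then show ?thesis using sub by simp
qed

lemma hw_earlier_edge:
  assumes "c \<ge> 1" "(u, v) \<in> hardware_edges m c"
  shows "u \<in> hw_earlier m c v \<or> v \<in> hw_earlier m c u"
  using assms(2) unfolding hardware_edges_def
proof (elim UnE)
  assume "(u, v) \<in> cell_edges m c"
  then obtain a b d d' where uv: "u = (a, b, d)" "v = (a, b, d')" "1 \<le> a" "d \<le> c" "c < d'" "d' \<le> 2 * c"
    by (auto simp: cell_edges_def)
  then have "v \<in> hw_earlier m c u"
    by (simp add: hw_earlier_def)
  then show ?thesis ..
next
  assume "(u, v) \<in> vertical_edges m c"
  then obtain a b d where "u = (a, b, d)" "v = (a + 1, b, d)" "a < m" "d \<le> c"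
    by (auto simp: vertical_edges_def)
  then have "v \<in> hw_earlier m c u"
    by (simp add: hw_earlier_def)
  then show ?thesis ..
next
  assume "(u, v) \<in> horizontal_edges m c"
  then obtain a b d where uv: "u = (a, b, d)" "v = (a, b + 1, d)" "a \<in> {1..m}" "1 \<le> b" "b < m"
    "d \<in> {c + 1..2 * c}"
    by (auto simp: horizontal_edges_def)
  then have "u \<in> right_vertices m c" "v \<in> right_vertices m c"
    by (auto simp: right_vertices_def)
  \<comment> \<open>The coupling spans exactly \<open>m * c\<close> numbers, so \<open>u\<close> is
    the oldest vertex in the window of \<open>v\<close>.\<close>
  moreover have "right_index m c v = right_index m c u + m * c" "0 < m * c"
    using uv assms(1) by (auto simp: right_index_def algebra_simps)
  ultimately have "u \<in> hw_earlier m c v"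
    using hw_earlier_right by auto
  then show ?thesis ..
qed

lemma hardware_graph_decomposition:
  assumes "m \<ge> 1" "c \<ge> 1"
  obtains T :: "nat pair_pre_digraph" and bag
  where "tree_decomposition (hardware_graph m c) T bag" "decomposition_width T bag \<le> int (c * m)"
proof (rule elimination_tree_decomposition[where G = "hardware_graph m c" and r = "(1, 1, c + 1)"
      and N = "hw_earlier m c" and par = "hw_parent m c" and f = "hw_rank m c" and k = "c * m"])
  let ?r = "(1, 1, c + 1)"
  show "?r \<in> pverts (hardware_graph m c)" "finite (pverts (hardware_graph m c))"
    using assms by (auto simp: hardware_graph_def)
  have "?r \<in> right_vertices m c"
    using assms by (auto simp: right_vertices_def)
  \<comment> \<open>The root has the smallest number, so its window is empty.\<close>
  moreover have "\<not> right_index m c w < right_index m c ?r" if "w \<in> right_vertices m c" for w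
    using that right_index_ge[of "fst w" "fst (snd w)" "snd (snd w)" m c] by simp
  ultimately show "hw_earlier m c ?r = {}"
    by (auto simp: hw_earlier_right)
  show "u \<in> pverts (hardware_graph m c) \<and> v \<in> pverts (hardware_graph m c) \<and>
      (u \<in> hw_earlier m c v \<or> v \<in> hw_earlier m c u)"
    if "(u, v) \<in> parcs (hardware_graph m c)" for u v
  proof -
    have uv: "(u, v) \<in> hardware_edges m c \<or> (v, u) \<in> hardware_edges m c"
      using that by (auto simp: hardware_graph_def)
    then have "u \<in> hw_earlier m c v \<or> v \<in> hw_earlier m c u"
      using hw_earlier_edge[OF assms(2)] by blast
    moreover have "u \<in> pverts (hardware_graph m c)" "v \<in> pverts (hardware_graph m c)"
      using uv hardware_edges_subset[of m c] by auto
    ultimately show ?thesis by blast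
  qed
qed (rule hw_parent_earlier[OF assms] hw_earlier_bounds[OF assms(2)] that; assumption)+

section \<open>The exact value and the stated bounds\<close>

theorem treewidth_hardware_graph:
  assumes "m \<ge> 1" "c \<ge> 1"
  shows "treewidth (hardware_graph m c) = int (c * m)"
proof -
  obtain T :: "nat pair_pre_digraph" and bag
    where T: "tree_decomposition (hardware_graph m c) T bag" "decomposition_width T bag \<le> int (c * m)"
    using hardware_graph_decomposition[OF assms] .
  have lower: "int (c * m) \<le> decomposition_width T' bag'"
    if "tree_decomposition (hardware_graph m c) T' bag'" for T' :: "nat pair_pre_digraph" and bag'
    using hardware_graph_decomposition_width[OF assms that] .
  show ?thesis
    unfolding treewidth_def
  proof (rule Least_equality)
    show "\<exists>(T :: nat pair_pre_digraph) bag. tree_decomposition (hardware_graph m c) T bag \<and>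
        int (c * m) = decomposition_width T bag"
      using T lower[OF T(1)] by (intro exI[of _ T] exI[of _ bag]) simp
  qed (use lower in blast)
qed

theorem theorem1:
  fixes m c :: nat
  assumes "m \<ge> 1" and "c \<ge> 1"
  shows "treewidth (hardware_graph 1 c) = int c \<and>
    (m \<ge> 2 \<longrightarrow>
       int c * int m \<le> treewidth (hardware_graph m c) \<and>
       treewidth (hardware_graph m c) \<le> int c * int m + int c - 1)"
  \<comment> \<open>The exact value \<open>c * m\<close> is at most \<open>c * m + c - 1\<close>
    because \<open>c \<ge> 1\<close>.\<close>
  using treewidth_hardware_graph[OF _ assms(2), of 1] treewidth_hardware_graph[OF assms] assms(2)
  by simp

end
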